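(* Let $v\in C^0([0,T],\mathbb{R}_{>0})$. Then there exists a continuous function $\omega_4:\mathbb{R}_{>0}\to\mathbb{R}_{>0}$ such that $$\Delta C(\boldsymbol\delta;v;j)\le\omega_4(\rho_j)\,\Delta C(\boldsymbol\delta;v;\arg\min_i\rho_i)$$ for all $n\ge1$, all $\boldsymbol\delta=(\boldsymbol h,\boldsymbol t,\boldsymbol\rho)\in\aleph_n$ and all $j\in\{0,\ldots,n\}$.
   Context: Constants $L,P,T>0$ are fixed; $\|\cdot\|_\infty$ is the max norm. For $n\ge1$, $\aleph_n$ is the set of all $\boldsymbol\delta=(\boldsymbol h,\boldsymbol t,\boldsymbol\rho)$ with $\boldsymbol h=(h_1,\ldots,h_n)\in\mathbb{R}^n_{>0}$, $\boldsymbol t=(t_0,\ldots,t_n)$, $\boldsymbol\rho=(\rho_0,\ldots,\rho_n)\in\mathbb{R}^{n+1}_{>0}$ such that $t_k=\sum_{j=1}^kh_j$ for $0\le k\le n$, $t_n=T$, $\|\boldsymbol h\|_\infty\le\frac1{4L}$, $\|\boldsymbol\rho\|_\infty\le\frac P{8L}$, $\rho_j/\rho_k\in\{4^\ell:\ell\in\mathbb{Z}\}$ for all $j,k\in\{0,\ldots,n\}$, and $\rho_j=2LPh_j^2$ for all $j\in\{1,\ldots,n\}$. $\aleph:=\bigcup_{n\ge1}\aleph_n$. Subdivision rule: $\psi[\boldsymbol\delta;0]:=(\boldsymbol h,\boldsymbol t,(\rho_0/4,\rho_1,\ldots,\rho_n))$. For $j\in\{1,\ldots,n\}$, $\psi[\boldsymbol\delta;j]$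 has components $(h_1,\ldots,h_{j-1},h_j/2,h_j/2,h_{j+1},\ldots,h_n)$, $(t_0,\ldots,t_{j-1},t_j-h_j/2,t_j,t_{j+1},\ldots,t_n)$, $(\rho_0,\ldots,\rho_{j-1},\rho_j/4,\rho_j/4,\rho_{j+1},\ldots,\rho_n)$. Dimensions: consider the differential inclusion $\dot x(t)\in F(x(t))$ a.e. in $(0,T)$, $x(0)\in X_0$, in $\mathbb{R}^d$, with $X_0$ nonempty, compact and path-connected and $F$ an $L$-Lipschitz (Hausdorff distance, max norm) map with nonempty compact convex values bounded by $P$; let $\mathcal{R}^F(t)$ be its reachable set at time $t$. Then $d_R:=\min(d-1,\max_{t\in[0,T]}\dim\mathcal{R}^F(t))$ and $d_F:=\min(d-1,\max_{t\in[0,T]}\max_{x\in\mathcal{R}^F(t)}\dim F(x))$; it is assumed that $d_R\ge1$. They enter the claim only as fixed integers $d_R\ge1$, $d_F\ge0$. Cost function: $\sigma(h,\rho):=\frac\rho4(1+Lh)\big(\frac{1+Lh}{1-Lh}+6\big)$ and $$C(\boldsymbol\delta;v):=\sum_{k=0}^{n-1}\frac{4v(t_k)h_{k+1}^{d_F}}{\rho_k^{d_R}\min(\rho_k,\rho_{k+1})^{d_F+1}}\,\sigma(h_{k+1},\rho_k),\qquad \Delta C(\boldsymbol\delta;v;j):=C(\psi[\boldsymbol\delta;j];v)-C(\boldsymbol\delta;v).$$ Convention: $\arg\min_i\rho_i$ denotes any index $k\in\{0,\ldots,n\}$ with $\rho_k=\min_i\rho_i$; the claim is meant for every such index. *)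

theory Defs
  imports "HOL-Analysis.Analysis"
begin

text \<open>
  A discretisation is a triple \<open>(h, t, \<rho>)\<close> of lists. For \<open>n = length h\<close> steps, \<open>t = [t_0, \<dots>, t_n]\<close>
  and \<open>\<rho> = [\<rho>_0, \<dots>, \<rho>_n]\<close> are indexed from 0, so that \<open>t_k\<close> is \<open>t ! k\<close>, but \<open>h = [h_1, \<dots>, h_n]\<close> is
  indexed from 1 in the mathematics, so that \<open>h_j\<close> is \<open>h ! (j - 1)\<close> and \<open>h_{k+1}\<close> is \<open>h ! k\<close>.
\<close>

type_synonym discretisation = "real list \<times> real list \<times> real list"

definition max_norm :: "real list \<Rightarrow> real" where
  "max_norm xs = Max (abs ` set xs)"

definition aleph :: "real \<Rightarrow> real \<Rightarrow> real \<Rightarrow> nat \<Rightarrow> discretisation set" where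
  "aleph L P T n = {(h, t, \<rho>).
     length h = n \<and> length t = n + 1 \<and> length \<rho> = n + 1 \<and>
     (\<forall>x\<in>set h. 0 < x) \<and> (\<forall>r\<in>set \<rho>. 0 < r) \<and>
     (\<forall>k\<in>{0..n}. t ! k = (\<Sum>j=1..k. h ! (j - 1))) \<and> t ! n = T \<and>
     max_norm h \<le> 1 / (4 * L) \<and> max_norm \<rho> \<le> P / (8 * L) \<and>
     (\<forall>j\<in>{0..n}. \<forall>k\<in>{0..n}. \<rho> ! j / \<rho> ! k \<in> range (\<lambda>l::int. 4 powi l)) \<and>
     (\<forall>j\<in>{1..n}. \<rho> ! j = 2 * L * P * (h ! (j - 1))\<^sup>2)}"

text \<open>Only indices \<open>j \<le> n\<close> are meaningful.\<close>

fun subdivide :: "discretisation \<Rightarrow> nat \<Rightarrow> discretisation" where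
  "subdivide (h, t, \<rho>) j =
     (if j = 0 then (h, t, \<rho>[0 := \<rho> ! 0 / 4])
      else (take (j - 1) h @ [h ! (j - 1) / 2, h ! (j - 1) / 2] @ drop j h,
            take j t @ [t ! j - h ! (j - 1) / 2, t ! j] @ drop (j + 1) t,
            take j \<rho> @ [\<rho> ! j / 4, \<rho> ! j / 4] @ drop (j + 1) \<rho>))"

definition sigma :: "real \<Rightarrow> real \<Rightarrow> real \<Rightarrow> real" where
  "sigma L h r = r / 4 * (1 + L * h) * ((1 + L * h) / (1 - L * h) + 6)"

fun cost :: "real \<Rightarrow> nat \<Rightarrow> nat \<Rightarrow> discretisation \<Rightarrow> (real \<Rightarrow> real) \<Rightarrow> real" where
  "cost L d\<^sub>R d\<^sub>F (h, t, \<rho>) v =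
     (\<Sum>k<length h.
        4 * v (t ! k) * (h ! k) ^ d\<^sub>F /
        ((\<rho> ! k) ^ d\<^sub>R * (min (\<rho> ! k) (\<rho> ! (k + 1))) ^ (d\<^sub>F + 1)) *
        sigma L (h ! k) (\<rho> ! k))"

definition cost_diff :: "real \<Rightarrow> nat \<Rightarrow> nat \<Rightarrow> discretisation \<Rightarrow> (real \<Rightarrow> real) \<Rightarrow> nat \<Rightarrow> real" where
  "cost_diff L d\<^sub>R d\<^sub>F \<delta> v j = cost L d\<^sub>R d\<^sub>F (subdivide \<delta> j) v - cost L d\<^sub>R d\<^sub>F \<delta> v"

end

theory Submission
  imports Defs
begin

text \<open>
  Write \<open>r\<close> for the minimum of the \<open>\<rho>\<^sub>i\<close>, let \<open>r = 2 L P s\<^sup>2\<close>, and put \<open>N = d\<^sub>R + d\<^sub>F\<close> and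
  \<open>\<Phi> = s ^ d\<^sub>F / r ^ N\<close>. Subdividing at a minimal index only increases the summands that survive,
  and adds (or increases one by) at least \<open>(min v) \<Phi>\<close>. Subdividing at \<open>j\<close> changes the
  summands of the two intervals adjacent to \<open>t\<^sub>j\<close>. Since the \<open>\<rho>\<^sub>i\<close> differ by powers of 4, a
  neighbour of \<open>\<rho>\<^sub>j\<close> is either at least \<open>\<rho>\<^sub>j\<close>, and the new summand is \<open>O(\<rho>\<^sub>j ^ -N)\<close>, or at
  most \<open>\<rho>\<^sub>j / 4\<close>. In the latter case the minimum in the denominator is unaffected, so that the
  halved left interval contributes no increase, while the right one contributes
  \<open>O(h\<^sub>j\<^sub>+\<^sub>1 ^ d\<^sub>F / \<rho>\<^sub>j\<^sub>+\<^sub>1 ^ (d\<^sub>F + 1) / r ^ (d\<^sub>R - 1)) = O(\<Phi>)\<close> because \<open>\<rho>\<^sub>j\<^sub>+\<^sub>1 = 2 L P h\<^sub>j\<^sub>+\<^sub>1\<^sup>2\<close>. As \<open>\<Phi>\<close>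
  is bounded below by a constant, \<open>\<omega>\<^sub>4 x = A / x ^ N + B\<close> works.
\<close>

text \<open>
  The cost of an interval of length \<open>h\<close> with left and right values \<open>a\<close>, \<open>b\<close> of \<open>\<rho>\<close> and \<open>v = w\<close> at its
  left end is \<open>w * growth L h * weight d e h a b\<close>, with \<open>d = d\<^sub>R - 1\<close> and \<open>e = d\<^sub>F\<close>: the factor \<open>a\<close>
  of \<open>sigma\<close> cancels one power of \<open>a\<close> in the denominator.
\<close>

definition growth :: "real \<Rightarrow> real \<Rightarrow> real" where
  "growth L h = (1 + L * h) * ((1 + L * h) / (1 - L * h) + 6)"

definition weight :: "nat \<Rightarrow> nat \<Rightarrow> real \<Rightarrow> real \<Rightarrow> real \<Rightarrow> real" where
  "weight d e h a b = h ^ e / (a ^ d * min a b ^ (e + 1))"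

definition summand :: "real \<Rightarrow> nat \<Rightarrow> nat \<Rightarrow> real \<Rightarrow> real \<Rightarrow> real \<Rightarrow> real \<Rightarrow> real" where
  "summand L d\<^sub>R e w h a b = 4 * w * h ^ e / (a ^ d\<^sub>R * min a b ^ (e + 1)) * sigma L h a"

lemma summand_eq:
  assumes "a > 0"
  shows "summand L (Suc d) e w h a b = w * growth L h * weight d e h a b"
  using assms by (simp add: summand_def sigma_def growth_def weight_def)

lemma cost_eq:
  "cost L d\<^sub>R e (h, t, \<rho>) v
     = (\<Sum>k<length h. summand L d\<^sub>R e (v (t ! k)) (h ! k) (\<rho> ! k) (\<rho> ! (k + 1)))"
  by (simp add: summand_def)

section \<open>Bounds for \<open>growth\<close> and \<open>weight\<close>\<close>

lemma growth_mono:
  assumes "L > 0" "0 \<le> x" "x \<le> y" "y \<le> 1 / (4 * L)"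
  shows "growth L x \<le> growth L y"
proof -
  have "L * x \<le> L * y" "L * y \<le> 1 / 4" "0 \<le> L * x"
    using assms by (auto simp: field_simps)
  moreover from \<open>L * x \<le> L * y\<close> \<open>L * y \<le> 1 / 4\<close> have "L * x \<le> 1" by linarith
  ultimately show ?thesis
    unfolding growth_def using assms by (intro mult_mono add_mono frac_le add_nonneg_nonneg divide_nonneg_nonneg) auto
qed

lemma growth_ge:
  assumes "L > 0" "0 \<le> x" "x \<le> 1 / (4 * L)"
  shows "7 \<le> growth L x"
  using growth_mono[of L 0 x] assms by (simp add: growth_def)

text \<open>At \<open>L * x = 1 / 4\<close> the value is \<open>5/4 * (5/3 + 6) = 115/12\<close>.
  Together with the lower bound 7, any two values in this range differ by a factor below 4, which
  the gain in \<open>weight_halve\<close> can absorb.\<close>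

lemma growth_le:
  assumes "L > 0" "0 \<le> x" "x \<le> 1 / (4 * L)"
  shows "growth L x \<le> 10"
proof -
  have "growth L (1 / (4 * L)) \<le> 10"
    using assms by (simp add: growth_def)
  then show ?thesis using growth_mono[of L x "1 / (4 * L)"] assms by simp
qed

lemma weight_nonneg: "h \<ge> 0 \<Longrightarrow> a > 0 \<Longrightarrow> b > 0 \<Longrightarrow> 0 \<le> weight d e h a b"
  by (simp add: weight_def)

lemma weight_mono:
  assumes "0 \<le> h" "h \<le> h'" "0 < a'" "a' \<le> a" "0 < b'" "b' \<le> b"
  shows "weight d e h a b \<le> weight d e h' a' b'"
  unfolding weight_def using assms
  by (intro frac_le mult_mono power_mono mult_pos_pos zero_less_power) (auto simp: min_def)

text \<open>When the left value is the smaller one, all powers merge into the single exponent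
  \<open>Suc d + e\<close>, which is \<open>N\<close> in the final proof.\<close>

lemma weight_diag:
  assumes "0 < a" "a \<le> b"
  shows "weight d e h a b = h ^ e / a ^ (Suc d + e)"
  using assms by (simp add: weight_def min_def power_add)

lemma weight_quarter_diag:
  assumes "0 < a" "a / 4 \<le> b"
  shows "weight d e h (a / 4) b = 4 ^ (Suc d + e) * (h ^ e / a ^ (Suc d + e))"
  using weight_diag[of "a / 4" b d e h] assms by (simp add: power_divide)

lemma four_le_four_power_div: "(4::real) \<le> 4 ^ (e + 1) / 2 ^ e"
proof -
  have "(4::real) ^ (e + 1) / 2 ^ e = 4 * 2 ^ e"
    using power_mult_distrib[of "2::real" 2 e] by simp
  then show ?thesis by simp
qed

text \<open>Halving \<open>h\<close> loses \<open>2 ^ e\<close>, quartering the minimum gains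
  \<open>4 ^ (e + 1)\<close>; the net factor is \<open>2 ^ (e + 2)\<close>.\<close>

lemma weight_halve:
  assumes "0 \<le> h" "0 < b" "b \<le> a"
  shows "4 * weight d e h a b \<le> weight d e (h / 2) a (b / 4)"
proof -
  have "weight d e (h / 2) a (b / 4) = 4 ^ (e + 1) / 2 ^ e * weight d e h a b"
    using assms by (simp add: weight_def power_divide)
  then show ?thesis
    using mult_right_mono[OF four_le_four_power_div[of e] weight_nonneg[of h a b d e]] assms
    by simp
qed

text \<open>Up to a constant this is a power of \<open>h\<close> with exponent
  \<open>e - 2 * N\<close>, nonpositive because \<open>e \<le> N\<close>. It serves to compare
  actual steps with the minimal \<open>s\<close>, and \<open>s\<close> with the largest admissible
  step.\<close>

lemma monomial_antimono:
  fixes c s h :: real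
  assumes "0 < c" "0 < s" "s \<le> h" "e \<le> N"
  shows "h ^ e / (c * h\<^sup>2) ^ N \<le> s ^ e / (c * s\<^sup>2) ^ N"
proof -
  have eq: "x ^ e / (c * x\<^sup>2) ^ N = 1 / (c ^ N * x ^ (2 * N - e))" if "x > 0" for x :: real
  proof -
    have "(c * x\<^sup>2) ^ N = c ^ N * (x ^ (2 * N - e) * x ^ e)"
      using assms(4) by (simp add: power_mult_distrib flip: power_mult power_add)
    then show ?thesis using that by simp
  qed
  show ?thesis
    using assms by (auto simp: eq intro!: frac_le mult_left_mono power_mono mult_pos_pos zero_less_power)
qed

text \<open>A power of 4 below 1 is at most 1/4. Hence quartering the larger of two values never
  takes it below the smaller one.\<close>

lemma power_four_gap:
  fixes x y :: real
  assumes "x / y \<in> range (\<lambda>l::int. 4 powi l)" "0 < x" "0 < y"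
  shows "y \<le> x \<or> x \<le> y / 4"
proof -
  obtain l :: int where l: "x / y = 4 powi l" using assms(1) by blast
  show ?thesis
  proof (cases "l \<ge> 0")
    case True
    then have "1 \<le> x / y" using l by (simp add: one_le_power_int)
    then show ?thesis using assms by simp
  next
    case False
    then have "(4::real) powi l \<le> 4 powi (- 1)" by (intro power_int_increasing) auto
    then have "x / y \<le> 1 / 4" using l by simp
    then show ?thesis using assms by (simp add: field_simps)
  qed
qed

section \<open>Cost differences in terms of the summands that change\<close>

lemma sum_lessThan_add:
  fixes f :: "nat \<Rightarrow> real"
  shows "sum f {..<i + m} = sum f {..<i} + (\<Sum>k<m. f (i + k))"
  by (induction m) auto

lemma cost_diff_0:
  assumes "length h = n" "length \<rho> = n + 1" "n \<ge> 1"
  shows "cost_diff L d\<^sub>R e (h, t, \<rho>) v 0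
     = summand L d\<^sub>R e (v (t ! 0)) (h ! 0) (\<rho> ! 0 / 4) (\<rho> ! 1)
       - summand L d\<^sub>R e (v (t ! 0)) (h ! 0) (\<rho> ! 0) (\<rho> ! 1)"
proof -
  obtain m where m: "n = Suc m" using assms(3) by (cases n) auto
  show ?thesis
    using assms unfolding cost_diff_def subdivide.simps if_P[OF refl] cost_eq m
    by (simp add: sum.lessThan_Suc_shift del: sum.lessThan_Suc)
qed

text \<open>With node index \<open>Suc i\<close>, the halved step is \<open>h ! i\<close>. The first
  three terms replace the interval left of the node by its two halves; the conditional accounts for
  the last node, which has no interval to its right.\<close>

lemma cost_diff_Suc:
  assumes "length h = n" "length t = n + 1" "length \<rho> = n + 1" "i < n"
  shows "cost_diff L d\<^sub>R e (h, t, \<rho>) v (Suc i)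
     = summand L d\<^sub>R e (v (t ! i)) (h ! i / 2) (\<rho> ! i) (\<rho> ! Suc i / 4)
       - summand L d\<^sub>R e (v (t ! i)) (h ! i) (\<rho> ! i) (\<rho> ! Suc i)
       + summand L d\<^sub>R e (v (t ! Suc i - h ! i / 2)) (h ! i / 2) (\<rho> ! Suc i / 4) (\<rho> ! Suc i / 4)
       + (if Suc i < n
          then summand L d\<^sub>R e (v (t ! Suc i)) (h ! Suc i) (\<rho> ! Suc i / 4) (\<rho> ! Suc (Suc i))
             - summand L d\<^sub>R e (v (t ! Suc i)) (h ! Suc i) (\<rho> ! Suc i) (\<rho> ! Suc (Suc i))
          else 0)"
proof -
  define h' where "h' = take i h @ [h ! i / 2, h ! i / 2] @ drop (Suc i) h"
  define t' where "t' = take (Suc i) t @ [t ! Suc i - h ! i / 2, t ! Suc i] @ drop (Suc i + 1) t"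
  define \<rho>' where "\<rho>' = take (Suc i) \<rho> @ [\<rho> ! Suc i / 4, \<rho> ! Suc i / 4] @ drop (Suc i + 1) \<rho>"
  define f where "f = (\<lambda>k. summand L d\<^sub>R e (v (t ! k)) (h ! k) (\<rho> ! k) (\<rho> ! (k + 1)))"
  define f' where "f' = (\<lambda>k. summand L d\<^sub>R e (v (t' ! k)) (h' ! k) (\<rho>' ! k) (\<rho>' ! (k + 1)))"
  obtain m where n: "n = i + Suc m"
    using assms(4) less_iff_Suc_add by auto
  have len: "length h' = i + Suc (Suc m)" using assms n by (simp add: h'_def)
  have diff: "cost_diff L d\<^sub>R e (h, t, \<rho>) v (Suc i) = sum f' {..<i + Suc (Suc m)} - sum f {..<i + Suc m}"
    using assms len n
    by (simp add: cost_diff_def cost_eq h'_def t'_def \<rho>'_def f_def f'_def del: cost.simps sum.lessThan_Suc)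
  have before: "f' k = f k" if "k < i" for k
    using that assms by (simp add: f_def f'_def h'_def t'_def \<rho>'_def nth_append)
  have after: "f' (i + Suc (Suc (Suc k))) = f (i + Suc (Suc k))" if "Suc k < m" for k
    using that assms n by (simp add: f_def f'_def h'_def t'_def \<rho>'_def nth_append)
  have split': "sum f' {..<i + Suc (Suc m)} = sum f {..<i} + f' i + f' (i + 1) + (\<Sum>k<m. f' (i + Suc (Suc k)))"
    unfolding sum_lessThan_add by (simp add: before sum.lessThan_Suc_shift del: sum.lessThan_Suc)
  have split: "sum f {..<i + Suc m} = sum f {..<i} + f i + (\<Sum>k<m. f (i + Suc k))"
    unfolding sum_lessThan_add by (simp add: sum.lessThan_Suc_shift del: sum.lessThan_Suc)
  \<comment> \<open>Past the new node the indices are shifted by one, so only the leading terms of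
    the two tails differ.\<close>
  have tail: "(\<Sum>k<m. f' (i + Suc (Suc k))) - (\<Sum>k<m. f (i + Suc k))
      = (if Suc i < n then f' (i + 2) - f (i + 1) else 0)"
  proof (cases m)
    case 0
    then show ?thesis using n by simp
  next
    case (Suc m')
    then have "(\<Sum>k<m'. f' (i + Suc (Suc (Suc k)))) = (\<Sum>k<m'. f (i + Suc (Suc k)))"
      using after by (intro sum.cong) auto
    then show ?thesis using Suc n by (simp add: sum.lessThan_Suc_shift del: sum.lessThan_Suc)
  qed
  have "f' i = summand L d\<^sub>R e (v (t ! i)) (h ! i / 2) (\<rho> ! i) (\<rho> ! Suc i / 4)"
    using assms by (simp add: f'_def h'_def t'_def \<rho>'_def nth_append)
  moreover have "f' (i + 1) = summand L d\<^sub>R e (v (t ! Suc i - h ! i / 2)) (h ! i / 2) (\<rho> ! Suc i / 4) (\<rho> ! Suc i / 4)"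
    using assms by (simp add: f'_def h'_def t'_def \<rho>'_def nth_append)
  moreover have "f' (i + 2) = summand L d\<^sub>R e (v (t ! Suc i)) (h ! Suc i) (\<rho> ! Suc i / 4) (\<rho> ! Suc (Suc i))"
    if "Suc i < n"
    using assms that by (simp add: f'_def h'_def t'_def \<rho>'_def nth_append)
  ultimately show ?thesis
    unfolding diff split split' using tail by (simp add: f_def)
qed

section \<open>Estimates for the change of a single summand\<close>

lemma quarter_left_ge:
  assumes "L > 0" "0 \<le> h" "h \<le> 1 / (4 * L)" "0 \<le> w" "0 < a" "0 < b"
  shows "summand L (Suc d) e w h a b \<le> summand L (Suc d) e w h (a / 4) b"
  using assms growth_ge[of L h]
  by (simp add: summand_eq) (intro mult_left_mono weight_mono; simp)

text \<open>As \<open>r\<close> is the smaller value, quartering scales the weight by exactly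
  \<open>4 ^ (Suc d + e)\<close>. This serves node 0, whose \<rho> is not given by a step length, so
  that \<open>s\<close> may be smaller than \<open>h\<close>.\<close>

lemma quarter_left_ge_min:
  assumes "L > 0" "0 \<le> s" "s \<le> h" "h \<le> 1 / (4 * L)" "0 < w\<^sub>0" "w\<^sub>0 \<le> w" "0 < r" "r \<le> b"
  shows "w\<^sub>0 * (s ^ e / r ^ (Suc d + e))
     \<le> summand L (Suc d) e w h (r / 4) b - summand L (Suc d) e w h r b"
proof -
  let ?\<Phi> = "h ^ e / r ^ (Suc d + e)"
  have g: "7 \<le> growth L h" using assms growth_ge[of L h] by simp
  have four: "(4::real) \<le> 4 ^ (Suc d + e)" using power_increasing[of 1 "Suc d + e" "4::real"] by simp
  have \<Phi>: "s ^ e / r ^ (Suc d + e) \<le> ?\<Phi>" "0 \<le> s ^ e / r ^ (Suc d + e)"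
    using assms by (auto intro!: divide_right_mono power_mono)
  have "1 * 1 \<le> growth L h * (4 ^ (Suc d + e) - 1)"
    using g four by (intro mult_mono; linarith)
  then have "w\<^sub>0 * (s ^ e / r ^ (Suc d + e)) * 1 \<le> w * ?\<Phi> * (growth L h * (4 ^ (Suc d + e) - 1))"
    using assms \<Phi> by (intro mult_mono) auto
  also have "\<dots> = summand L (Suc d) e w h (r / 4) b - summand L (Suc d) e w h r b"
    using assms weight_diag[of r b d e h] weight_quarter_diag[of r b d e h]
    by (simp add: summand_eq algebra_simps del: power_Suc add_Suc)
  finally show ?thesis by simp
qed

text \<open>The weight gains a factor of at least 4, while \<open>growth\<close> drops at most from
  10 to 7.\<close>

lemma quarter_right_ge:
  assumes "L > 0" "0 \<le> h" "h \<le> 1 / (4 * L)" "0 \<le> w" "0 < b" "b \<le> a"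
  shows "summand L (Suc d) e w h a b \<le> summand L (Suc d) e w (h / 2) a (b / 4)"
proof -
  have "growth L h * weight d e h a b \<le> growth L (h / 2) * (4 * weight d e h a b)"
    using growth_le[of L h] growth_ge[of L "h / 2"] weight_nonneg[of h a b d e] assms
      mult_right_mono[of "growth L h" "growth L (h / 2) * 4" "weight d e h a b"]
    by simp
  also have "\<dots> \<le> growth L (h / 2) * weight d e (h / 2) a (b / 4)"
    using growth_ge[of L "h / 2"] weight_halve[of h b a d e] assms
    by (intro mult_left_mono) auto
  finally show ?thesis
    using assms by (simp add: summand_eq mult_left_mono mult.assoc)
qed

lemma middle_ge:
  assumes "L > 0" "0 \<le> s" "s \<le> 1 / (4 * L)" "0 < w\<^sub>0" "w\<^sub>0 \<le> w" "0 < r"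
  shows "w\<^sub>0 * (s ^ e / r ^ (Suc d + e)) \<le> summand L (Suc d) e w (s / 2) (r / 4) (r / 4)"
proof -
  have g: "7 \<le> growth L (s / 2)" using assms growth_ge[of L "s / 2"] by simp
  have "(2::real) ^ e \<le> 4 ^ (Suc d + e)"
    using power_mono[of "2::real" 4 e] power_increasing[of e "Suc d + e" "4::real"] by simp
  then have "s ^ e / r ^ (Suc d + e) * 1 \<le> s ^ e / r ^ (Suc d + e) * (4 ^ (Suc d + e) / 2 ^ e)"
    using assms by (intro mult_left_mono) auto
  also have "\<dots> = weight d e (s / 2) (r / 4) (r / 4)"
    using assms weight_quarter_diag[of r "r / 4" d e "s / 2"]
    by (simp add: power_divide mult.commute del: power_Suc add_Suc)
  finally have "w\<^sub>0 * 1 * (s ^ e / r ^ (Suc d + e)) \<le> w * growth L (s / 2) * weight d e (s / 2) (r / 4) (r / 4)"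
    using assms g by (intro mult_mono) auto
  then show ?thesis using assms by (simp add: summand_eq)
qed

lemma summand_le:
  assumes "L > 0" "0 \<le> h" "h \<le> 1 / (4 * L)" "0 \<le> w" "w \<le> V" "0 < a" "0 < b"
    "weight d e h a b \<le> B"
  shows "summand L (Suc d) e w h a b \<le> V * 10 * B"
proof -
  have "w * growth L h * weight d e h a b \<le> V * 10 * B"
    using assms growth_ge[of L h] growth_le[of L h] weight_nonneg[of h a b d e]
    by (intro mult_mono) auto
  then show ?thesis using assms by (simp add: summand_eq)
qed

lemma summand_nonneg:
  assumes "L > 0" "0 \<le> h" "h \<le> 1 / (4 * L)" "0 \<le> w" "0 < a" "0 < b"
  shows "0 \<le> summand L (Suc d) e w h a b"
  using assms growth_ge[of L h] weight_nonneg[of h a b d e] by (simp add: summand_eq)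

lemma summand_quarter_le:
  assumes "L > 0" "0 \<le> h" "h \<le> 1 / (4 * L)" "0 \<le> w" "w \<le> V" "0 < x" "x / 4 \<le> a" "x / 4 \<le> b"
  shows "summand L (Suc d) e w h a b \<le> V * 10 * (4 ^ (Suc d + e) * ((1 / (4 * L)) ^ e / x ^ (Suc d + e)))"
proof (rule summand_le)
  have "weight d e h a b \<le> weight d e (1 / (4 * L)) (x / 4) (x / 4)"
    using assms by (intro weight_mono) auto
  also have "\<dots> = 4 ^ (Suc d + e) * ((1 / (4 * L)) ^ e / x ^ (Suc d + e))"
    using assms by (intro weight_quarter_diag) auto
  finally show "weight d e h a b \<le> 4 ^ (Suc d + e) * ((1 / (4 * L)) ^ e / x ^ (Suc d + e))" .
qed (use assms in auto)

lemma quarter_right_le: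
  assumes "L > 0" "0 \<le> h" "h \<le> 1 / (4 * L)" "0 \<le> w" "w \<le> V" "0 < a" "0 < b"
    "b \<le> a \<or> a \<le> b / 4"
  shows "summand L (Suc d) e w (h / 2) a (b / 4) - summand L (Suc d) e w h a b
     \<le> V * 10 * (4 ^ (Suc d + e) * ((1 / (4 * L)) ^ e / b ^ (Suc d + e)))"
  using assms(8)
proof
  assume "b \<le> a"
  then have "summand L (Suc d) e w (h / 2) a (b / 4)
      \<le> V * 10 * (4 ^ (Suc d + e) * ((1 / (4 * L)) ^ e / b ^ (Suc d + e)))"
    using assms by (intro summand_quarter_le) auto
  moreover have "0 \<le> summand L (Suc d) e w h a b" using assms by (intro summand_nonneg) auto
  ultimately show ?thesis by linarith
next
  assume *: "a \<le> b / 4"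
  then have "weight d e (h / 2) a (b / 4) = weight d e (h / 2) a b"
    using assms by (simp add: weight_def min_def)
  also have "\<dots> \<le> weight d e h a b" using assms by (intro weight_mono) auto
  finally have "growth L (h / 2) * weight d e (h / 2) a (b / 4) \<le> growth L h * weight d e h a b"
    using assms growth_mono[of L "h / 2" h] growth_ge[of L h] weight_nonneg[of "h / 2" a "b / 4" d e]
    by (intro mult_mono) auto
  then have "summand L (Suc d) e w (h / 2) a (b / 4) \<le> summand L (Suc d) e w h a b"
    using assms by (simp add: summand_eq mult_left_mono mult.assoc)
  moreover have "0 \<le> V * 10 * (4 ^ (Suc d + e) * ((1 / (4 * L)) ^ e / b ^ (Suc d + e)))"
    using assms by simp
  ultimately show ?thesis by linarith
qed

text \<open>The last term covers \<open>b \<le> a / 4\<close>: the minimum is then \<open>b\<close>,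
  which \<open>a\<close> does not bound from below, so the estimate uses the global minimum
  \<open>r\<close> instead.\<close>

lemma quarter_left_le:
  assumes "L > 0" "0 < s" "s \<le> h" "h \<le> 1 / (4 * L)" "0 \<le> w" "w \<le> V" "0 < c"
    "b = c * h\<^sup>2" "r = c * s\<^sup>2" "r \<le> a" "b \<le> a / 4 \<or> a \<le> b"
  shows "summand L (Suc d) e w h (a / 4) b - summand L (Suc d) e w h a b
     \<le> V * 10 * (4 ^ (Suc d + e) * ((1 / (4 * L)) ^ e / a ^ (Suc d + e)))
        + V * 10 * (4 ^ d * (s ^ e / r ^ (Suc d + e)))"
proof -
  have r: "0 < r" using assms by simp
  have pos: "0 < a" "0 < h" "0 \<le> V" using assms r by linarith+
  then have b: "0 < b" using assms by simp
  note pos = pos r b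
  have nn: "0 \<le> V * 10 * (4 ^ (Suc d + e) * ((1 / (4 * L)) ^ e / a ^ (Suc d + e)))"
      "0 \<le> V * 10 * (4 ^ d * (s ^ e / r ^ (Suc d + e)))"
      "0 \<le> summand L (Suc d) e w h a b"
    using assms(1,2,4,5) pos summand_nonneg[of L h w a b d e] by simp_all
  from assms(11) show ?thesis
  proof
    assume *: "b \<le> a / 4"
    have "weight d e h (a / 4) b = 4 ^ d / a ^ d * (h ^ e / (c * h\<^sup>2) ^ (e + 1))"
      using * by (simp add: weight_def min_def power_divide assms(8))
    \<comment> \<open>The factor in \<open>a\<close> is estimated by \<open>r \<le> a\<close>, the
      one in \<open>h\<close> by \<open>monomial_antimono\<close> with exponent
      \<open>e + 1\<close>.\<close>
    also have "\<dots> \<le> 4 ^ d / r ^ d * (s ^ e / (c * s\<^sup>2) ^ (e + 1))"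
      using assms pos by (intro mult_mono monomial_antimono frac_le power_mono) auto
    also have "\<dots> = 4 ^ d * (s ^ e / r ^ (Suc d + e))"
      by (simp add: assms(9)[symmetric] power_add)
    finally have "summand L (Suc d) e w h (a / 4) b \<le> V * 10 * (4 ^ d * (s ^ e / r ^ (Suc d + e)))"
      using assms(1,4,5,6) pos by (intro summand_le) auto
    then show ?thesis using nn by linarith
  next
    assume "a \<le> b"
    then have "summand L (Suc d) e w h (a / 4) b
        \<le> V * 10 * (4 ^ (Suc d + e) * ((1 / (4 * L)) ^ e / a ^ (Suc d + e)))"
      using assms(1,4,5,6) pos by (intro summand_quarter_le) auto
    then show ?thesis using nn by linarith
  qed
qed

section \<open>Pointwise consequences of membership in \<open>aleph\<close>\<close>

lemma aleph_facts:
  assumes "(h, t, \<rho>) \<in> aleph L P T n" and "n \<ge> 1"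
  shows "length h = n" "length t = n + 1" "length \<rho> = n + 1"
    and "\<And>i. i < n \<Longrightarrow> 0 < h ! i" "\<And>i. i < n \<Longrightarrow> h ! i \<le> 1 / (4 * L)"
    and "\<And>i. i \<le> n \<Longrightarrow> 0 < \<rho> ! i"
    and "\<And>i. i < n \<Longrightarrow> \<rho> ! Suc i = 2 * L * P * (h ! i)\<^sup>2"
    and "\<And>i j. i \<le> n \<Longrightarrow> j \<le> n \<Longrightarrow> \<rho> ! j \<le> \<rho> ! i \<or> \<rho> ! i \<le> \<rho> ! j / 4"
    and "\<And>i. i \<le> n \<Longrightarrow> t ! i \<in> {0..T}"
    and "\<And>i. i < n \<Longrightarrow> t ! Suc i - h ! i / 2 \<in> {0..T}"
proof -
  note A = assms(1)[unfolded aleph_def mem_Collect_eq prod.case]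
  show len: "length h = n" "length t = n + 1" "length \<rho> = n + 1" using A by auto
  show hpos: "0 < h ! i" if "i < n" for i using A that by (simp add: len flip: len(1))
  show "h ! i \<le> 1 / (4 * L)" if "i < n" for i
  proof -
    have "\<bar>h ! i\<bar> \<le> max_norm h" unfolding max_norm_def using that len by (intro Max_ge) auto
    then show ?thesis using A hpos[OF that] by linarith
  qed
  show rpos: "0 < \<rho> ! i" if "i \<le> n" for i
    using A that len by (metis in_set_conv_nth less_Suc_eq_le Suc_eq_plus1)
  show "\<rho> ! Suc i = 2 * L * P * (h ! i)\<^sup>2" if "i < n" for i
    using A that by (metis Suc_leI atLeastAtMost_iff diff_Suc_1 le_add1 plus_1_eq_Suc)
  show "\<rho> ! j \<le> \<rho> ! i \<or> \<rho> ! i \<le> \<rho> ! j / 4" if "i \<le> n" "j \<le> n" for i j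
    using A that rpos by (intro power_four_gap) auto
  have t_eq: "t ! i = (\<Sum>j<i. h ! j)" if "i \<le> n" for i
  proof -
    have "t ! i = (\<Sum>j=1..i. h ! (j - 1))" using A that by auto
    also have "\<dots> = (\<Sum>j<i. h ! j)"
      by (rule sum.reindex_bij_witness[of _ Suc "\<lambda>j. j - 1"]) auto
    finally show ?thesis .
  qed
  show t: "t ! i \<in> {0..T}" if "i \<le> n" for i
  proof -
    have "(\<Sum>j<i. h ! j) \<le> (\<Sum>j<n. h ! j)"
      using that hpos by (intro sum_mono2) (auto intro: less_imp_le)
    moreover have "0 \<le> (\<Sum>j<i. h ! j)" using that hpos by (intro sum_nonneg) (auto intro: less_imp_le)
    moreover have "t ! n = T" using A by auto
    ultimately show ?thesis using t_eq[OF that] t_eq[of n] by simp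
  qed
  \<comment> \<open>The new node is the midpoint of \<open>t ! i\<close> and
    \<open>t ! Suc i\<close>, whose distance is \<open>h ! i\<close>.\<close>
  show "t ! Suc i - h ! i / 2 \<in> {0..T}" if "i < n" for i
    using t[of i] t[of "Suc i"] t_eq[of i] t_eq[of "Suc i"] hpos[OF that] that by auto
qed

theorem lemma6p6:
  fixes L P T :: real and d\<^sub>R d\<^sub>F :: nat and v :: "real \<Rightarrow> real"
  assumes "L > 0" and "P > 0" and "T > 0"
    and "d\<^sub>R \<ge> 1"
    and "continuous_on {0..T} v" and "\<forall>s\<in>{0..T}. v s > 0"
  shows "\<exists>\<omega>\<^sub>4 :: real \<Rightarrow> real.
           continuous_on {0<..} \<omega>\<^sub>4 \<and> (\<forall>x>0. \<omega>\<^sub>4 x > 0) \<and>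
           (\<forall>n\<ge>1. \<forall>h t \<rho>. (h, t, \<rho>) \<in> aleph L P T n \<longrightarrow>
             (\<forall>j\<in>{0..n}. \<forall>k\<in>{0..n}. \<rho> ! k = Min (set \<rho>) \<longrightarrow>
               cost_diff L d\<^sub>R d\<^sub>F (h, t, \<rho>) v j
                 \<le> \<omega>\<^sub>4 (\<rho> ! j) * cost_diff L d\<^sub>R d\<^sub>F (h, t, \<rho>) v k))"
proof -
  obtain d where d: "d\<^sub>R = Suc d" using assms(4) by (cases d\<^sub>R) auto
  have ne: "{0..T} \<noteq> {}" using assms(3) by simp
  obtain a where a: "a \<in> {0..T}" "\<And>x. x \<in> {0..T} \<Longrightarrow> v a \<le> v x"
    using continuous_attains_inf[OF compact_Icc ne assms(5)] by blast
  obtain b where b: "b \<in> {0..T}" "\<And>x. x \<in> {0..T} \<Longrightarrow> v x \<le> v b"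
    using continuous_attains_sup[OF compact_Icc ne assms(5)] by blast
  define w where "w = v a"
  define V where "V = v b"
  have w: "0 < w" using a assms(6) by (auto simp: w_def)
  have V: "0 < V" using b assms(6) by (auto simp: V_def)
  have v: "w \<le> v x" "v x \<le> V" "0 \<le> v x" if "x \<in> {0..T}" for x
    using a(2)[OF that] b(2)[OF that] w by (auto simp: w_def V_def)
  define N where "N = Suc d + d\<^sub>F"
  define c where "c = 2 * L * P"
  have c: "0 < c" using assms by (simp add: c_def)
  define H where "H = 1 / (4 * L)"
  have H: "0 < H" using assms by (simp add: H_def)
  define \<Phi>\<^sub>0 where "\<Phi>\<^sub>0 = H ^ d\<^sub>F / (c * H\<^sup>2) ^ N"
  have \<Phi>\<^sub>0: "0 < \<Phi>\<^sub>0" using c H by (simp add: \<Phi>\<^sub>0_def)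
  define E where "E = V * 10 * (4 ^ N * H ^ d\<^sub>F)"
  have E: "0 < E" using V H by (simp add: E_def)
  define D where "D = V * 10 * 4 ^ d"
  have D: "0 < D" using V by (simp add: D_def)
  \<comment> \<open>The 3 counts the summands bounded by \<open>E / x ^ N\<close>: left half, right
    half, right neighbour. Dividing by \<open>\<Phi>\<^sub>0\<close> turns them into multiples of
    \<Phi>, \<open>D\<close> is the coefficient from \<open>quarter_left_le\<close>, and
    \<open>w\<close> comes from the lower bound \<open>w * \<Phi>\<close>.\<close>
  define \<omega> where "\<omega> = (\<lambda>x::real. (3 * (E / x ^ N) / \<Phi>\<^sub>0 + D) / w)"
  have "continuous_on {0<..} \<omega>"
    unfolding \<omega>_def using \<Phi>\<^sub>0 w by (intro continuous_intros) auto
  moreover have \<omega>_pos: "\<omega> x > 0" if "x > 0" for x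
    using that \<Phi>\<^sub>0 w E D by (simp add: \<omega>_def add_pos_pos)
  moreover have "cost_diff L d\<^sub>R d\<^sub>F (h, t, \<rho>) v j \<le> \<omega> (\<rho> ! j) * cost_diff L d\<^sub>R d\<^sub>F (h, t, \<rho>) v k"
    if n: "n \<ge> 1" and al: "(h, t, \<rho>) \<in> aleph L P T n" and j: "j \<le> n" and k: "k \<le> n"
      and min: "\<rho> ! k = Min (set \<rho>)" for n h t \<rho> j k
  proof -
    note F = aleph_facts[OF al n]
    define r where "r = \<rho> ! k"
    define s where "s = sqrt (r / c)"
    define \<Phi> where "\<Phi> = s ^ d\<^sub>F / r ^ N"
    have r: "0 < r" using F(6) k by (simp add: r_def)
    have r_le: "r \<le> \<rho> ! i" if "i \<le> n" for i
      unfolding r_def min using that F(3) by (intro Min_le) auto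
    have s: "0 < s" and rs: "r = c * s\<^sup>2" using r c by (simp_all add: s_def)
    have rho: "\<rho> ! Suc i = c * (h ! i)\<^sup>2" if "i < n" for i using F(7)[OF that] by (simp add: c_def)
    have s_le: "s \<le> h ! i" if "i < n" for i
    proof -
      have "c * s\<^sup>2 \<le> c * (h ! i)\<^sup>2" using r_le[of "Suc i"] rho[OF that] that rs by simp
      then show ?thesis using c F(4)[OF that] by (auto intro: power2_le_imp_le)
    qed
    have "s \<le> H" using s_le[of 0] F(5)[of 0] n by (simp add: H_def)
    then have \<Phi>_ge: "\<Phi>\<^sub>0 \<le> \<Phi>"
      unfolding \<Phi>_def \<Phi>\<^sub>0_def rs using s c by (intro monomial_antimono) (auto simp: N_def)
    have lower: "w * \<Phi> \<le> cost_diff L d\<^sub>R d\<^sub>F (h, t, \<rho>) v k"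
    proof (cases k)
      case 0
      have "w * (s ^ d\<^sub>F / r ^ (Suc d + d\<^sub>F))
        \<le> summand L (Suc d) d\<^sub>F (v (t ! 0)) (h ! 0) (r / 4) (\<rho> ! 1)
          - summand L (Suc d) d\<^sub>F (v (t ! 0)) (h ! 0) r (\<rho> ! 1)"
        using assms(1) s r n w v F(5)[of 0] F(9)[of 0] r_le[of 1] s_le[of 0]
        by (intro quarter_left_ge_min) auto
      then show ?thesis
        unfolding d 0 cost_diff_0[OF F(1,3) n] by (simp add: r_def 0 \<Phi>_def N_def)
    next
      case (Suc i)
      then have i: "i < n" using k by simp
      \<comment> \<open>At a minimal node other than 0, the relation between \<rho> and the step
        length forces the step to its left to be \<open>s\<close>.\<close>
      have hi: "h ! i = s"
      proof -
        have "c * (h ! i)\<^sup>2 = c * s\<^sup>2" using rho[OF i] rs by (simp add: r_def Suc)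
        then show ?thesis using c s F(4)[OF i] by (simp add: power2_eq_iff_nonneg)
      qed
      have "summand L (Suc d) d\<^sub>F (v (t ! i)) (h ! i) (\<rho> ! i) (\<rho> ! Suc i)
          \<le> summand L (Suc d) d\<^sub>F (v (t ! i)) (h ! i / 2) (\<rho> ! i) (\<rho> ! Suc i / 4)"
        using assms(1) F(4,5)[OF i] F(6)[of "Suc i"] F(9)[of i] i v r_le[of i]
        by (intro quarter_right_ge) (auto simp: r_def Suc)
      moreover have "w * (s ^ d\<^sub>F / r ^ (Suc d + d\<^sub>F))
          \<le> summand L (Suc d) d\<^sub>F (v (t ! Suc i - h ! i / 2)) (h ! i / 2) (\<rho> ! Suc i / 4) (\<rho> ! Suc i / 4)"
        using assms(1) F(5)[OF i] F(10)[OF i] w v s r unfolding hi r_def Suc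
        by (intro middle_ge) auto
      moreover have "summand L (Suc d) d\<^sub>F (v (t ! Suc i)) (h ! Suc i) (\<rho> ! Suc i) (\<rho> ! Suc (Suc i))
          \<le> summand L (Suc d) d\<^sub>F (v (t ! Suc i)) (h ! Suc i) (\<rho> ! Suc i / 4) (\<rho> ! Suc (Suc i))"
        if "Suc i < n"
        using assms(1) F(4,5)[OF that] F(6)[of "Suc i"] F(6)[of "Suc (Suc i)"] F(9)[of "Suc i"] v that
        by (intro quarter_left_ge) auto
      ultimately show ?thesis
        unfolding d Suc cost_diff_Suc[OF F(1,2,3) i] \<Phi>_def N_def by (auto split: if_splits)
    qed
    have E_nonneg: "0 \<le> E / \<rho> ! j ^ N" "0 \<le> D * \<Phi>"
      using E D F(6)[OF j] \<Phi>_ge \<Phi>\<^sub>0 by auto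
    have left: "summand L (Suc d) d\<^sub>F (v (t ! j)) (h ! j) (\<rho> ! j / 4) (\<rho> ! Suc j)
        - summand L (Suc d) d\<^sub>F (v (t ! j)) (h ! j) (\<rho> ! j) (\<rho> ! Suc j) \<le> E / \<rho> ! j ^ N + D * \<Phi>"
      if "j < n"
    proof -
      have "summand L (Suc d) d\<^sub>F (v (t ! j)) (h ! j) (\<rho> ! j / 4) (\<rho> ! Suc j)
          - summand L (Suc d) d\<^sub>F (v (t ! j)) (h ! j) (\<rho> ! j) (\<rho> ! Suc j)
        \<le> V * 10 * (4 ^ (Suc d + d\<^sub>F) * ((1 / (4 * L)) ^ d\<^sub>F / \<rho> ! j ^ (Suc d + d\<^sub>F)))
          + V * 10 * (4 ^ d * (s ^ d\<^sub>F / r ^ (Suc d + d\<^sub>F)))"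
        using assms(1) s c s_le[OF that] F(5)[OF that] F(8)[of "Suc j" j] F(9)[of j] v rho[OF that] rs
          r_le[of j] that
        by (intro quarter_left_le) auto
      then show ?thesis by (simp add: E_def D_def \<Phi>_def N_def H_def)
    qed
    have upper: "cost_diff L d\<^sub>R d\<^sub>F (h, t, \<rho>) v j \<le> 3 * (E / \<rho> ! j ^ N) + D * \<Phi>"
    proof (cases j)
      case 0
      then show ?thesis
        using left E_nonneg n unfolding d 0 cost_diff_0[OF F(1,3) n] by simp
    next
      case (Suc i)
      then have i: "i < n" using j by simp
      have "summand L (Suc d) d\<^sub>F (v (t ! i)) (h ! i / 2) (\<rho> ! i) (\<rho> ! Suc i / 4)
          - summand L (Suc d) d\<^sub>F (v (t ! i)) (h ! i) (\<rho> ! i) (\<rho> ! Suc i)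
        \<le> V * 10 * (4 ^ (Suc d + d\<^sub>F) * ((1 / (4 * L)) ^ d\<^sub>F / \<rho> ! Suc i ^ (Suc d + d\<^sub>F)))"
        using assms(1) F(4,5)[OF i] F(6)[of i] F(6)[of "Suc i"] F(8)[of i "Suc i"] F(9)[of i] v i
        by (intro quarter_right_le) auto
      moreover have "summand L (Suc d) d\<^sub>F (v (t ! Suc i - h ! i / 2)) (h ! i / 2) (\<rho> ! Suc i / 4) (\<rho> ! Suc i / 4)
        \<le> V * 10 * (4 ^ (Suc d + d\<^sub>F) * ((1 / (4 * L)) ^ d\<^sub>F / \<rho> ! Suc i ^ (Suc d + d\<^sub>F)))"
        using assms(1) F(4,5)[OF i] F(6)[of "Suc i"] F(10)[OF i] v i
        by (intro summand_quarter_le) auto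
      moreover have "V * 10 * (4 ^ (Suc d + d\<^sub>F) * ((1 / (4 * L)) ^ d\<^sub>F / \<rho> ! Suc i ^ (Suc d + d\<^sub>F)))
          = E / \<rho> ! j ^ N"
        by (simp add: E_def N_def H_def Suc)
      ultimately show ?thesis
        using left E_nonneg unfolding d Suc cost_diff_Suc[OF F(1,2,3) i] by (auto split: if_splits)
    qed
    \<comment> \<open>The ratio \<open>\<Phi> / \<Phi>\<^sub>0\<close> is at least 1, so the term
      without \<Phi> may be multiplied by it.\<close>
    have "3 * (E / \<rho> ! j ^ N) + D * \<Phi> \<le> 3 * (E / \<rho> ! j ^ N) * (\<Phi> / \<Phi>\<^sub>0) + D * \<Phi>"
      using mult_left_mono[of 1 "\<Phi> / \<Phi>\<^sub>0" "3 * (E / \<rho> ! j ^ N)"] E_nonneg(1) \<Phi>_ge \<Phi>\<^sub>0 by simp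
    also have "\<dots> = \<omega> (\<rho> ! j) * (w * \<Phi>)"
      using w by (simp add: \<omega>_def field_simps)
    also have "\<dots> \<le> \<omega> (\<rho> ! j) * cost_diff L d\<^sub>R d\<^sub>F (h, t, \<rho>) v k"
      using lower \<omega>_pos[of "\<rho> ! j"] F(6)[OF j] by (intro mult_left_mono) auto
    finally show ?thesis using upper by linarith
  qed
  ultimately show ?thesis by (intro exI[of _ \<omega>]) auto
qed

end
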